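(* Consider the finite-horizon linear quadratic regulation (LQR) problem: compute an optimal control law $\boldsymbol{u}^*(t)$ which minimizes $$J=\tfrac12\,\boldsymbol{x}^T(t_f)F(t_f)\boldsymbol{x}(t_f)+\tfrac12\int_{t_0}^{t_f}\big(\boldsymbol{x}^T(t)Q(t)\boldsymbol{x}(t)+\boldsymbol{u}^T(t)R(t)\boldsymbol{u}(t)\big)\,dt$$ subject to $\dot{\boldsymbol{x}}(t)=A(t)\boldsymbol{x}(t)+B(t)\boldsymbol{u}(t)$, and drives the states of the system to zero (regulation), where $\boldsymbol{x}(t_0)=\boldsymbol{x}_0$ is given, $\boldsymbol{x}(t_f)$ is free, $t_f$ is fixed, and $Q(t)\succeq0$, $R(t)\succ0$ for all $t\in[t_0,t_f]$. Let the Krotov function be selected as $$q(\boldsymbol{x},t)=\boldsymbol{x}^TP(t)\boldsymbol{x},$$ where every element of the matrix $P(t)$ is differentiable for all $t\in[t_0,t_f)$. Then the following statements are true: 1. The function $q=\boldsymbol{x}^TP\boldsymbol{x}$ is a solving function for the equivalent optimization problem of the LQR problem (defined in the context). 2. The global optimal control law for the LQR problem is given by $$\boldsymbol{u}^*=-\tfrac12 R^{-1}B^T\big(P^T+P\big)\boldsymbol{x},$$ where $P$ is the solution of the matrix differential equation $$\dot P+PA+A^TP+Q-\tfrac12 PBR^{-1}B^TP-\tfrac14 PBR^{-1}B^TP^T-\tfrac14 P^TBR^{-1}B^TP=0$$ with the final value $P(t_f)=F(t_f)$.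
   Context: Here $\boldsymbol{x}(t)\in\mathbb{R}^n$ is the state, $\boldsymbol{u}(t)\in\mathbb{R}^m$ is the control input, $A,B,Q,R$ are matrices of compatible sizes depending on $t$, $F(t_f)$ and $P(t)$ are $n\times n$ matrices ($P$ is not required to be symmetric or positive definite), and the argument $t$ is often dropped. $M\succeq0$ / $M\succ0$ denote positive semidefinite / positive definite. An admissible process is a pair $(\boldsymbol{x}(t),\boldsymbol{u}(t))$ which satisfies the dynamical equation (with the given initial state) and the input/state constraints; here no input or state constraints are imposed. Equivalent optimization problem: for a Krotov function $q(\boldsymbol{x},t)$ (in general, any continuously differentiable function), and using $2J$ as the cost functional in place of $J$, put $$s(\boldsymbol{x},\boldsymbol{u},t)=\frac{\partial q}{\partial t}+\frac{\partial q}{\partial\boldsymbol{x}}[A\boldsymbol{x}+B\boldsymbol{u}]+\boldsymbol{x}^TQ\boldsymbol{x}+\boldsymbol{u}^TR\boldsymbol{u},\qquad s_f(\boldsymbol{x}(t_f))=\boldsymbol{x}^T(t_f)F(t_f)\boldsymbol{x}(t_f)-q(\boldsymbol{x}(t_f),t_f).$$ The problem is to compute an admissible process $(\boldsymbol{x}^*,\boldsymbol{u}^* )$ which attains $\min_{(\boldsymbol{x},\boldsymbol{u})\in\mathbb{R}^n\times\mathbb{R}^m}s(\boldsymbol{x},\boldsymbol{u},t)$ for all $t\in[t_0,t_f)$ and $\min_{\boldsymbol{x}\in\mathbb{R}^n}s_f(\boldsymbol{x})$ at $t=t_f$. The function $q$ is called a solving function if this problem is feasible, i.e. if an admissible process attaining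 these minima can be found.
   Formalization: A, B, Q, R are assumed continuous on [t0,tf]; in both statements P is assumed to solve the matrix differential equation on [t0,tf), with P(tf)=F(tf) also the limit of P(t) as t tends to tf. *)

theory Defs
  imports "HOL-Analysis.Analysis"
begin

text \<open>As usual, semidefiniteness and definiteness of a real matrix include symmetry.\<close>

definition psd_matrix :: "real^'n^'n \<Rightarrow> bool" where
  "psd_matrix M \<longleftrightarrow> transpose M = M \<and> (\<forall>v. 0 \<le> v \<bullet> (M *v v))"

definition pd_matrix :: "real^'n^'n \<Rightarrow> bool" where
  "pd_matrix M \<longleftrightarrow> transpose M = M \<and> (\<forall>v. v \<noteq> 0 \<longrightarrow> 0 < v \<bullet> (M *v v))"

text \<open>The finite exceptional set admits controls with finitely many jumps; at all other instants
  the dynamics hold classically (one-sidedly at the two end points).\<close>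

definition admissible ::
  "real \<Rightarrow> real \<Rightarrow> (real \<Rightarrow> real^'n^'n) \<Rightarrow> (real \<Rightarrow> real^'m^'n) \<Rightarrow> real^'n
    \<Rightarrow> (real \<Rightarrow> real^'n) \<Rightarrow> (real \<Rightarrow> real^'m) \<Rightarrow> bool" where
  "admissible t0 tf A B x0 x u \<longleftrightarrow>
     x t0 = x0 \<and> continuous_on {t0..tf} x \<and>
     (\<exists>S. finite S \<and> (\<forall>t\<in>{t0..tf} - S.
        (x has_vector_derivative (A t *v x t + B t *v u t)) (at t within {t0..tf})))"

definition running_cost ::
  "(real \<Rightarrow> real^'n^'n) \<Rightarrow> (real \<Rightarrow> real^'m^'m) \<Rightarrow> (real \<Rightarrow> real^'n) \<Rightarrow> (real \<Rightarrow> real^'m)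
    \<Rightarrow> real \<Rightarrow> real" where
  "running_cost Q R x u t = x t \<bullet> (Q t *v x t) + u t \<bullet> (R t *v u t)"

definition lqr_cost ::
  "real \<Rightarrow> real \<Rightarrow> (real \<Rightarrow> real^'n^'n) \<Rightarrow> (real \<Rightarrow> real^'m^'m) \<Rightarrow> real^'n^'n
    \<Rightarrow> (real \<Rightarrow> real^'n) \<Rightarrow> (real \<Rightarrow> real^'m) \<Rightarrow> real" where
  "lqr_cost t0 tf Q R F x u =
     1/2 * (x tf \<bullet> (F *v x tf)) + 1/2 * integral {t0..tf} (running_cost Q R x u)"

text \<open>The integral of a non-integrable function is 0 by convention, so integrability of the running
  cost is required explicitly, on both sides of the comparison. As the running cost is non-negative
  in the LQR problem, the processes left out are those whose cost is infinite or undefined.\<close>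

definition globally_optimal ::
  "real \<Rightarrow> real \<Rightarrow> (real \<Rightarrow> real^'n^'n) \<Rightarrow> (real \<Rightarrow> real^'m^'n) \<Rightarrow> (real \<Rightarrow> real^'n^'n)
    \<Rightarrow> (real \<Rightarrow> real^'m^'m) \<Rightarrow> real^'n^'n \<Rightarrow> real^'n
    \<Rightarrow> (real \<Rightarrow> real^'n) \<Rightarrow> (real \<Rightarrow> real^'m) \<Rightarrow> bool" where
  "globally_optimal t0 tf A B Q R F x0 x u \<longleftrightarrow>
     admissible t0 tf A B x0 x u \<and> running_cost Q R x u integrable_on {t0..tf} \<and>
     (\<forall>y v. admissible t0 tf A B x0 y v \<and> running_cost Q R y v integrable_on {t0..tf}
        \<longrightarrow> lqr_cost t0 tf Q R F x u \<le> lqr_cost t0 tf Q R F y v)"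

text \<open>A feedback law \<open>k\<close> (state and time to control) is globally optimal if the closed loop has a
  trajectory and every closed-loop process is globally optimal.\<close>

definition optimal_control_law ::
  "real \<Rightarrow> real \<Rightarrow> (real \<Rightarrow> real^'n^'n) \<Rightarrow> (real \<Rightarrow> real^'m^'n) \<Rightarrow> (real \<Rightarrow> real^'n^'n)
    \<Rightarrow> (real \<Rightarrow> real^'m^'m) \<Rightarrow> real^'n^'n \<Rightarrow> real^'n
    \<Rightarrow> (real^'n \<Rightarrow> real \<Rightarrow> real^'m) \<Rightarrow> bool" where
  "optimal_control_law t0 tf A B Q R F x0 k \<longleftrightarrow>
     (\<exists>x. admissible t0 tf A B x0 x (\<lambda>t. k (x t) t)) \<and>
     (\<forall>x u. admissible t0 tf A B x0 x u \<and> (\<forall>t\<in>{t0..tf}. u t = k (x t) t)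
        \<longrightarrow> globally_optimal t0 tf A B Q R F x0 x u)"

text \<open>Continuously differentiable on \<open>[t0, tf)\<close>, with spatial gradient \<open>gx\<close> and time derivative
  \<open>gt\<close>, and continuous up to \<open>tf\<close>, so that the terminal value of \<open>q\<close> is tied to the values before.\<close>

definition krotov_function :: "real \<Rightarrow> real \<Rightarrow> (real^'n \<Rightarrow> real \<Rightarrow> real) \<Rightarrow> bool" where
  "krotov_function t0 tf q \<longleftrightarrow>
     continuous_on (UNIV \<times> {t0..tf}) (\<lambda>(x, t). q x t) \<and>
     (\<exists>gx gt. continuous_on (UNIV \<times> {t0..<tf}) gx \<and> continuous_on (UNIV \<times> {t0..<tf}) gt \<and>
        (\<forall>x. \<forall>t\<in>{t0..<tf}.
           ((\<lambda>(y, r). q y r) has_derivative (\<lambda>(h, k). gx (x, t) \<bullet> h + gt (x, t) * k))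
             (at (x, t) within UNIV \<times> {t0..tf})))"

text \<open>The functions of the equivalent problem, normalised for the cost functional \<open>2 J\<close>. The time
  derivative is taken within \<open>[t0, tf]\<close>, hence one-sided at \<open>t0\<close>.\<close>

definition krotov_s ::
  "real \<Rightarrow> real \<Rightarrow> (real \<Rightarrow> real^'n^'n) \<Rightarrow> (real \<Rightarrow> real^'m^'n) \<Rightarrow> (real \<Rightarrow> real^'n^'n)
    \<Rightarrow> (real \<Rightarrow> real^'m^'m) \<Rightarrow> (real^'n \<Rightarrow> real \<Rightarrow> real)
    \<Rightarrow> real^'n \<Rightarrow> real^'m \<Rightarrow> real \<Rightarrow> real" where
  "krotov_s t0 tf A B Q R q x u t =
     vector_derivative (\<lambda>r. q x r) (at t within {t0..tf})
     + frechet_derivative (\<lambda>y. q y t) (at x) (A t *v x + B t *v u)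
     + x \<bullet> (Q t *v x) + u \<bullet> (R t *v u)"

definition krotov_sf ::
  "real \<Rightarrow> real^'n^'n \<Rightarrow> (real^'n \<Rightarrow> real \<Rightarrow> real) \<Rightarrow> real^'n \<Rightarrow> real" where
  "krotov_sf tf F q x = x \<bullet> (F *v x) - q x tf"

definition solving_function ::
  "real \<Rightarrow> real \<Rightarrow> (real \<Rightarrow> real^'n^'n) \<Rightarrow> (real \<Rightarrow> real^'m^'n) \<Rightarrow> (real \<Rightarrow> real^'n^'n)
    \<Rightarrow> (real \<Rightarrow> real^'m^'m) \<Rightarrow> real^'n^'n \<Rightarrow> real^'n \<Rightarrow> (real^'n \<Rightarrow> real \<Rightarrow> real) \<Rightarrow> bool" where
  "solving_function t0 tf A B Q R F x0 q \<longleftrightarrow>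
     krotov_function t0 tf q \<and>
     (\<exists>x u. admissible t0 tf A B x0 x u \<and>
        (\<forall>t\<in>{t0..<tf}.
           is_arg_min (\<lambda>(y, v). krotov_s t0 tf A B Q R q y v t) (\<lambda>_. True) (x t, u t)) \<and>
        is_arg_min (krotov_sf tf F q) (\<lambda>_. True) (x tf))"

end

theory Submission
  imports Defs
begin

text \<open>Krotov's sufficient condition for optimality, carried out for a quadratic function
  \<open>q = x \<bullet> (P *v x)\<close>. Along any process the derivative of \<open>q\<close> is \<open>s\<close> minus the running cost, and the
  terminal condition \<open>P tf = F\<close> makes \<open>s\<^sub>f\<close> vanish identically; so twice the cost is the fixed number
  \<open>x0 \<bullet> (P t0 *v x0)\<close> plus the integral of \<open>s\<close> (lemma \<open>residual_has_integral\<close>). The matrix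
  differential equation is made so that \<open>s\<close> is a complete square in the control,
  \<open>s = (u - k) \<bullet> (R *v (u - k))\<close> with \<open>k\<close> the feedback control (lemma \<open>riccati_complete_square\<close>): only
  the quadratic form of \<open>P\<close> enters, and the symmetric part of \<open>P\<close> satisfies the classical Riccati
  equation. As \<open>R\<close> is positive definite, \<open>s\<close> is non-negative and vanishes on the closed loop, whatever
  the state is. This gives at once the pointwise minimality that a solving function requires and the
  global optimality of the feedback law.

  What remains is analysis. The closed loop must have a trajectory on the whole of \<open>[t0, tf]\<close>; it is
  a linear equation, continuous because matrix inversion is (lemmas \<open>continuous_on_matrix_inv\<close>,
  \<open>linear_ode_solution_exists\<close>). And \<open>q\<close> must be continuously differentiable before \<open>tf\<close>, which
  follows as the equation expresses the derivative of \<open>P\<close> by continuous functions.\<close>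

section \<open>Continuity of matrix operations\<close>

lemma bounded_bilinear_matrix_vector_mult:
  "bounded_bilinear ((*v) :: real^'n^'m \<Rightarrow> real^'n \<Rightarrow> real^'m)"
  unfolding bilinear_conv_bounded_bilinear[symmetric] bilinear_def linear_iff
  by (simp add: algebra_simps scaleR_matrix_vector_assoc)

lemma bounded_bilinear_matrix_matrix_mult:
  "bounded_bilinear ((**) :: real^'n^'m \<Rightarrow> real^'k^'n \<Rightarrow> real^'k^'m)"
  unfolding bilinear_conv_bounded_bilinear[symmetric] bilinear_def linear_iff
  by (auto simp: vec_eq_iff matrix_matrix_mult_def
      sum_distrib_left sum.distrib algebra_simps)

lemma bounded_linear_transpose:
  "bounded_linear (transpose :: real^'n^'m \<Rightarrow> real^'m^'n)"
  unfolding linear_conv_bounded_linear[symmetric] linear_iff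
  by (simp add: transpose_scalar) (simp add: transpose_def vec_eq_iff)

lemmas continuous_on_matrix_vector_mult =
  bounded_bilinear.continuous_on[OF bounded_bilinear_matrix_vector_mult]
lemmas continuous_on_matrix_matrix_mult =
  bounded_bilinear.continuous_on[OF bounded_bilinear_matrix_matrix_mult]
lemmas continuous_on_transpose =
  bounded_linear.continuous_on[OF bounded_linear_transpose]
lemmas continuous_on_matrix_intros = continuous_on_matrix_vector_mult
  continuous_on_matrix_matrix_mult continuous_on_transpose

lemma continuous_on_det:
  fixes M :: "'a::topological_space \<Rightarrow> real^'n^'n"
  assumes "continuous_on S M"
  shows "continuous_on S (\<lambda>t. det (M t))"
  unfolding det_def by (intro continuous_intros assms)

lemma matrix_inv_works:
  fixes A :: "real^'n^'m"
  assumes "invertible A"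
  shows "A ** matrix_inv A = mat 1" "matrix_inv A ** A = mat 1"
  using someI_ex[OF assms[unfolded invertible_def]] unfolding matrix_inv_def by auto

text \<open>Cramer's rule, applied to each column of the identity, writes every entry of the inverse as a
  quotient of determinants; this makes the continuity of inversion a matter of polynomials.\<close>

lemma matrix_inv_cramer:
  fixes A :: "real^'n^'n"
  assumes "invertible A"
  shows "matrix_inv A =
    (\<chi> k l. det (\<chi> i j. if j = k then mat 1 $ i $ l else A $ i $ j) / det A)"
proof -
  have "matrix_inv A $ k $ l = det (\<chi> i j. if j = k then mat 1 $ i $ l else A $ i $ j) / det A" for k l
  proof -
    have "A *v column l (matrix_inv A) = column l (mat 1)"
      by (metis matrix_inv_works(1)[OF assms] matrix_vector_mul_assoc matrix_vector_mult_basis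
          matrix_vector_mul_lid)
    then have "column l (matrix_inv A) =
        (\<chi> k. det (\<chi> i j. if j = k then column l (mat 1) $ i else A $ i $ j) / det A)"
      using assms cramer invertible_det_nz by blast
    then show ?thesis
      by (simp only: vec_eq_iff column_def vec_lambda_beta)
  qed
  then show ?thesis
    by (simp add: vec_eq_iff)
qed

lemma continuous_on_matrix_inv:
  fixes M :: "'a::topological_space \<Rightarrow> real^'n^'n"
  assumes "continuous_on S M" and inv: "\<And>t. t \<in> S \<Longrightarrow> invertible (M t)"
  shows "continuous_on S (\<lambda>t. matrix_inv (M t))"
proof -
  have "continuous_on S (\<lambda>t. if j = k then mat 1 $ i $ l else M t $ i $ j)" for i j k l
    by (cases "j = k") (auto intro!: continuous_intros assms)
  then have "continuous_on S
      (\<lambda>t. \<chi> k l. det (\<chi> i j. if j = k then mat 1 $ i $ l else M t $ i $ j) / det (M t))"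
    using inv by (intro continuous_on_vec_lambda continuous_on_divide continuous_on_det assms)
      (auto simp: invertible_det_nz)
  then show ?thesis
    by (rule continuous_on_eq) (simp add: matrix_inv_cramer[OF inv])
qed

lemma invertible_pd_matrix:
  assumes "pd_matrix M"
  shows "invertible M"
proof -
  have "x = 0" if "M *v x = 0" for x
    using assms that by (force simp: pd_matrix_def)
  then show ?thesis
    using matrix_left_invertible_ker[of M] invertible_left_inverse[of M] by blast
qed

section \<open>Global solutions of linear differential equations\<close>

text \<open>The closed loop is a linear equation with continuous coefficients, and its solution must exist on
  the whole interval. The Picard increments \<open>\<phi> n\<close>, with \<open>\<phi> 0\<close> constant and
  \<open>\<phi> (n + 1) t\<close> the integral of \<open>M *v \<phi> n\<close> up to \<open>t\<close>, are bounded by the terms of an exponential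
  series. Hence the series of their derivatives converges uniformly, and termwise differentiation
  turns the sum of the increments into a solution.\<close>

lemma linear_ode_solution_exists:
  fixes M :: "real \<Rightarrow> real^'n^'n"
  assumes "a \<le> b" and M: "continuous_on {a..b} M"
  obtains x where "x a = x0"
    and "\<And>t. t \<in> {a..b} \<Longrightarrow> (x has_vector_derivative M t *v x t) (at t within {a..b})"
proof -
  interpret mv: bounded_bilinear "(*v) :: real^'n^'n \<Rightarrow> real^'n \<Rightarrow> real^'n"
    by (rule bounded_bilinear_matrix_vector_mult)
  obtain C where "C \<ge> 0" and C: "\<And>t v. t \<in> {a..b} \<Longrightarrow> norm (M t *v v) \<le> C * norm v"
  proof -
    obtain K where K: "K > 0" "\<And>(N :: real^'n^'n) v. norm (N *v v) \<le> norm N * norm v * K"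
      using mv.pos_bounded by metis
    obtain D where "D > 0" and D: "\<And>t. t \<in> {a..b} \<Longrightarrow> norm (M t) \<le> D"
      using compact_imp_bounded[OF compact_continuous_image[OF M compact_Icc]]
      by (auto simp: bounded_pos)
    have "norm (M t *v v) \<le> (D * K) * norm v" if "t \<in> {a..b}" for t v
    proof -
      have "norm (M t) * norm v * K \<le> D * norm v * K"
        using D[OF that] K(1) by (intro mult_right_mono) auto
      then show ?thesis
        using K(2)[of "M t" v] by (simp add: mult_ac)
    qed
    then show thesis
      using that[of "D * K"] \<open>D > 0\<close> \<open>K > 0\<close> by simp
  qed
  define \<phi> where "\<phi> = rec_nat (\<lambda>_. x0) (\<lambda>_ f t. integral {a..t} (\<lambda>s. M s *v f s))"
  have \<phi>_0: "\<phi> 0 = (\<lambda>_. x0)" and \<phi>_Suc: "\<phi> (Suc n) = (\<lambda>t. integral {a..t} (\<lambda>s. M s *v \<phi> n s))" for n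
    by (simp_all add: \<phi>_def)
  have cont: "continuous_on {a..b} (\<phi> n)" for n
  proof (induction n)
    case (Suc n)
    have "continuous_on {a..b} (\<lambda>s. M s *v \<phi> n s)"
      by (intro mv.continuous_on M Suc)
    then show ?case
      unfolding \<phi>_Suc by (intro indefinite_integral_continuous_1 integrable_continuous_real)
  qed (simp add: \<phi>_0)
  \<comment> \<open>\<open>\<psi> n\<close> is the derivative of \<open>\<phi> n\<close>; the shift of the index is what makes the sum solve the equation.\<close>
  define \<psi> where "\<psi> n t = (case n of 0 \<Rightarrow> 0 | Suc m \<Rightarrow> M t *v \<phi> m t)" for n t
  have deriv: "(\<phi> n has_vector_derivative \<psi> n t) (at t within {a..b})" if "t \<in> {a..b}" for n t
    using that by (cases n)
      (auto simp: \<psi>_def \<phi>_0 \<phi>_Suc intro!: integral_has_vector_derivative mv.continuous_on M cont)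
  \<comment> \<open>The pointwise factorial bound, in which the powers of \<open>t - a\<close> are kept because
    integrating them is what produces the next factorial.\<close>
  have bound: "norm (\<phi> n t) \<le> norm x0 * (C * (t - a)) ^ n / fact n" if "t \<in> {a..b}" for n t
    using that
  proof (induction n arbitrary: t)
    case (Suc n)
    have "((\<lambda>s. C * (norm x0 * (C * (s - a)) ^ n / fact n)) has_integral
        norm x0 * (C * (t - a)) ^ Suc n / fact (Suc n) - norm x0 * (C * (a - a)) ^ Suc n / fact (Suc n)) {a..t}"
    proof (rule fundamental_theorem_of_calculus)
      show "((\<lambda>s. norm x0 * (C * (s - a)) ^ Suc n / fact (Suc n)) has_vector_derivative
          C * (norm x0 * (C * (s - a)) ^ n / fact n)) (at s within {a..t})" for s
        unfolding has_real_derivative_iff_has_vector_derivative[symmetric]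
        by (auto intro!: derivative_eq_intros simp: divide_simps simp del: power_Suc)
          simp_all
    qed (use Suc.prems in auto)
    then have int: "((\<lambda>s. C * (norm x0 * (C * (s - a)) ^ n / fact n)) has_integral
        norm x0 * (C * (t - a)) ^ Suc n / fact (Suc n)) {a..t}"
      by simp
    have "norm (integral {a..t} (\<lambda>s. M s *v \<phi> n s))
        \<le> integral {a..t} (\<lambda>s. C * (norm x0 * (C * (s - a)) ^ n / fact n))"
    proof (rule integral_norm_bound_integral)
      show "(\<lambda>s. M s *v \<phi> n s) integrable_on {a..t}"
        using Suc.prems by (intro integrable_continuous_real mv.continuous_on
            continuous_on_subset[OF M] continuous_on_subset[OF cont]) auto
      show "norm (M s *v \<phi> n s) \<le> C * (norm x0 * (C * (s - a)) ^ n / fact n)" if "s \<in> {a..t}" for s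
      proof -
        have s: "s \<in> {a..b}"
          using that Suc.prems by auto
        have "norm (M s *v \<phi> n s) \<le> C * norm (\<phi> n s)"
          by (rule C[OF s])
        also have "\<dots> \<le> C * (norm x0 * (C * (s - a)) ^ n / fact n)"
          by (rule mult_left_mono[OF Suc.IH[OF s] \<open>C \<ge> 0\<close>])
        finally show ?thesis .
      qed
    qed (use int in blast)
    then show ?case
      by (simp only: \<phi>_Suc integral_unique[OF int])
  qed (simp add: \<phi>_0)
  define m where "m n = C * (norm x0 * ((C * (b - a)) ^ n / fact n))" for n
  have "summable m"
    unfolding m_def using summable_exp[of "C * (b - a)"]
    by (intro summable_mult) (simp add: field_simps)
  have \<phi>_le: "norm (\<phi> n t) \<le> norm x0 * ((C * (b - a)) ^ n / fact n)" if "t \<in> {a..b}" for n t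
  proof -
    have "(C * (t - a)) ^ n \<le> (C * (b - a)) ^ n"
      using that \<open>C \<ge> 0\<close> by (intro power_mono mult_left_mono) auto
    then have "norm x0 * (C * (t - a)) ^ n / fact n \<le> norm x0 * ((C * (b - a)) ^ n / fact n)"
      by (simp add: divide_right_mono mult_left_mono)
    then show ?thesis
      using bound[OF that, of n] by simp
  qed
  have \<psi>_le: "norm (\<psi> (Suc n) t) \<le> m n" if "t \<in> {a..b}" for n t
    using order_trans[OF C[OF that] mult_left_mono[OF \<phi>_le[OF that] \<open>C \<ge> 0\<close>]]
    by (simp add: \<psi>_def m_def)
  have "summable (\<lambda>n. case n of 0 \<Rightarrow> 0 | Suc n \<Rightarrow> m n)"
    using \<open>summable m\<close> by (subst summable_Suc_iff[symmetric]) simp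
  then have unif: "uniform_limit {a..b} (\<lambda>n t. \<Sum>i<n. \<psi> i t) (\<lambda>t. \<Sum>i. \<psi> i t) sequentially"
    by (rule Weierstrass_m_test[rotated]) (auto simp: \<psi>_le \<psi>_def[of 0] split: nat.split)
  have at_a: "(\<lambda>n. \<phi> n a) sums x0"
  proof -
    have "(\<lambda>n. \<phi> (Suc n) a) sums 0"
      by (simp add: \<phi>_Suc)
    then show ?thesis
      by (subst (asm) sums_Suc_iff) (simp add: \<phi>_0)
  qed
  have "\<exists>g. \<forall>t\<in>{a..b}. (\<lambda>n. \<phi> n t) sums g t \<and>
      (g has_derivative (\<lambda>h. h *\<^sub>R (\<Sum>n. \<psi> n t))) (at t within {a..b})"
  proof (rule has_derivative_series)
    show "(\<lambda>n. \<phi> n a) sums x0" by (rule at_a)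
    show "(\<phi> n has_derivative (\<lambda>h. h *\<^sub>R \<psi> n t)) (at t within {a..b})" if "t \<in> {a..b}" for n t
      using deriv[OF that] by (simp add: has_vector_derivative_def)
    show "\<forall>\<^sub>F n in sequentially. \<forall>t\<in>{a..b}. \<forall>h.
        norm ((\<Sum>i<n. h *\<^sub>R \<psi> i t) - h *\<^sub>R (\<Sum>n. \<psi> n t)) \<le> e * norm h" if "e > 0" for e
      using uniform_limitD[OF unif that]
    proof eventually_elim
      case (elim n)
      show ?case
      proof (intro ballI allI)
        fix t and h :: real assume "t \<in> {a..b}"
        then have "norm ((\<Sum>i<n. \<psi> i t) - (\<Sum>n. \<psi> n t)) \<le> e"
          using elim by (auto simp: dist_norm intro: less_imp_le)
        then have "\<bar>h\<bar> * norm ((\<Sum>i<n. \<psi> i t) - (\<Sum>n. \<psi> n t)) \<le> \<bar>h\<bar> * e"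
          by (rule mult_left_mono) simp
        then show "norm ((\<Sum>i<n. h *\<^sub>R \<psi> i t) - h *\<^sub>R (\<Sum>n. \<psi> n t)) \<le> e * norm h"
          by (simp add: scaleR_sum_right[symmetric] scaleR_diff_right[symmetric] mult.commute)
      qed
    qed
  qed (use \<open>a \<le> b\<close> in \<open>auto simp: convex_real_interval\<close>)
  then obtain g where g_sums: "\<And>t. t \<in> {a..b} \<Longrightarrow> (\<lambda>n. \<phi> n t) sums g t"
    and g_deriv: "\<And>t. t \<in> {a..b} \<Longrightarrow> (g has_vector_derivative (\<Sum>n. \<psi> n t)) (at t within {a..b})"
    unfolding has_vector_derivative_def by blast
  show thesis
  proof
    show "g a = x0"
      using g_sums[of a] at_a \<open>a \<le> b\<close> sums_unique2 by auto
    show "(g has_vector_derivative M t *v g t) (at t within {a..b})" if t: "t \<in> {a..b}" for t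
    proof -
      have "(\<lambda>n. \<psi> (Suc n) t) sums (M t *v g t)"
        unfolding \<psi>_def using bounded_linear.sums[OF mv.bounded_linear_right g_sums[OF t]] by simp
      then have "(\<lambda>n. \<psi> n t) sums (M t *v g t)"
        by (subst (asm) sums_Suc_iff) (simp add: \<psi>_def)
      then show ?thesis
        using g_deriv[OF t] by (simp add: sums_iff)
    qed
  qed
qed

section \<open>Derivatives of matrices and their quadratic forms\<close>

text \<open>Both the point and the matrix may vary, so that one rule covers the three derivatives needed: the
  joint one of the Krotov function in state and time, its spatial gradient (constant matrix), and
  its rate of change along a trajectory. The sum \<open>M + transpose M\<close> appears because \<open>M\<close> need not be
  symmetric.\<close>

lemma has_derivative_quadratic_form:
  fixes M :: "'a::real_normed_vector \<Rightarrow> real^'n^'n"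
  assumes "(y has_derivative y') (at z within S)" and "(M has_derivative M') (at z within S)"
  shows "((\<lambda>w. y w \<bullet> (M w *v y w)) has_derivative
    (\<lambda>h. ((M z + transpose (M z)) *v y z) \<bullet> y' h + y z \<bullet> (M' h *v y z))) (at z within S)"
proof -
  have "((\<lambda>w. y w \<bullet> (M w *v y w)) has_derivative
      (\<lambda>h. y z \<bullet> (M z *v y' h + M' h *v y z) + y' h \<bullet> (M z *v y z))) (at z within S)"
    by (intro has_derivative_inner bounded_bilinear.FDERIV[OF bounded_bilinear_matrix_vector_mult] assms)
  then show ?thesis
    by (simp add: algebra_simps inner_commute dot_lmul_matrix[symmetric])
qed

lemma has_vector_derivative_quadratic_form:
  fixes M :: "real \<Rightarrow> real^'n^'n"
  assumes "(x has_vector_derivative x') (at t within S)" and "(M has_vector_derivative M') (at t within S)"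
  shows "((\<lambda>r. x r \<bullet> (M r *v x r)) has_vector_derivative
    ((M t + transpose (M t)) *v x t) \<bullet> x' + x t \<bullet> (M' *v x t)) (at t within S)"
  using has_derivative_quadratic_form[OF assms[unfolded has_vector_derivative_def]]
  unfolding has_vector_derivative_def
  by (simp add: algebra_simps scaleR_matrix_vector_assoc[symmetric])

lemma matrix_differentiable_componentwise:
  fixes M :: "'a::real_normed_vector \<Rightarrow> real^'n^'m"
  assumes "\<And>i j. (\<lambda>w. M w $ i $ j) differentiable (at z within S)"
  shows "M differentiable (at z within S)"
  unfolding differentiable_componentwise_within[of M] using assms
  by (auto simp: Basis_vec_def inner_axis)

section \<open>Completing the square with the Riccati equation\<close>

lemma inner_matrix_vector_transpose: "x \<bullet> (M *v y) = (transpose M *v x) \<bullet> y"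
  for M :: "real^'n^'m"
  by (simp add: dot_lmul_matrix)

lemma transpose_matrix_inv:
  fixes R :: "real^'n^'n"
  assumes "invertible R" and "transpose R = R"
  shows "transpose (matrix_inv R) = matrix_inv R"
proof -
  have "transpose (matrix_inv R) ** R = mat 1"
    by (metis assms matrix_inv_works(1) matrix_transpose_mul transpose_mat)
  then show ?thesis
    by (metis assms(1) matrix_inv_works(1) matrix_mul_assoc matrix_mul_lid matrix_mul_rid)
qed

text \<open>The left-hand side is Krotov's \<open>s\<close> for \<open>q = x \<bullet> (P *v x)\<close>. With \<open>a\<close> and \<open>b\<close> the images of \<open>P *v x\<close>
  and \<open>transpose P *v x\<close> under \<open>transpose B\<close>, the terms that are linear in \<open>u\<close> add up to
  \<open>u \<bullet> (a + b)\<close>, so completing the square leaves the remainder \<open>- (1/4) (a + b) \<bullet> (N *v (a + b))\<close>,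
  where \<open>N\<close> is the inverse of \<open>R\<close>. Only the values of quadratic forms at \<open>x\<close> matter; there the three
  quadratic terms of the matrix equation, with their weights 1/2, 1/4 and 1/4, sum to exactly
  \<open>(1/4) (a + b) \<bullet> (N *v (a + b))\<close>. Equivalently, the symmetric part of \<open>P\<close> solves the classical
  Riccati equation.\<close>

lemma riccati_complete_square:
  fixes P P' A Q :: "real^'n^'n" and B :: "real^'m^'n" and R :: "real^'m^'m"
  assumes R: "pd_matrix R"
    and riccati: "P' + P ** A + transpose A ** P + Q
        - (1/2) *\<^sub>R (P ** B ** matrix_inv R ** transpose B ** P)
        - (1/4) *\<^sub>R (P ** B ** matrix_inv R ** transpose B ** transpose P)
        - (1/4) *\<^sub>R (transpose P ** B ** matrix_inv R ** transpose B ** P) = 0"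
    and k: "k = - (1/2) *\<^sub>R ((matrix_inv R ** transpose B ** (transpose P + P)) *v x)"
  shows "x \<bullet> (P' *v x) + ((P + transpose P) *v x) \<bullet> (A *v x + B *v u) + x \<bullet> (Q *v x) + u \<bullet> (R *v u)
    = (u - k) \<bullet> (R *v (u - k))"
proof -
  define N where "N = matrix_inv R"
  define a where "a = transpose B *v (P *v x)"
  define b where "b = transpose B *v (transpose P *v x)"
  have "invertible R" and R_sym: "transpose R = R"
    using R by (auto simp: invertible_pd_matrix pd_matrix_def)
  then have RN: "R ** N = mat 1" and N_sym: "transpose N = N"
    by (auto simp: N_def matrix_inv_works transpose_matrix_inv)
  have sym: "v \<bullet> (N *v w) = w \<bullet> (N *v v)" "v' \<bullet> (R *v w') = w' \<bullet> (R *v v')" for v w v' w'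
    by (metis N_sym inner_commute inner_matrix_vector_transpose)
       (metis R_sym inner_commute inner_matrix_vector_transpose)
  have cancel: "R *v (N *v w) = w" for w
    by (simp add: matrix_vector_mul_assoc RN)
  have k': "k = - (1/2) *\<^sub>R (N *v (a + b))"
    unfolding k a_def b_def N_def
    by (simp only: matrix_vector_mul_assoc[symmetric] matrix_vector_right_distrib
        matrix_vector_mult_add_rdistrib add.commute)
  have PBNBP: "x \<bullet> ((P ** B ** N ** transpose B ** P) *v x) = b \<bullet> (N *v a)"
    "x \<bullet> ((P ** B ** N ** transpose B ** transpose P) *v x) = b \<bullet> (N *v b)"
    "x \<bullet> ((transpose P ** B ** N ** transpose B ** P) *v x) = a \<bullet> (N *v a)"
    unfolding a_def b_def
    by (simp_all only: matrix_vector_mul_assoc[symmetric] inner_matrix_vector_transpose[of x]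
        inner_matrix_vector_transpose[of _ B] transpose_transpose
        inner_matrix_vector_transpose[of "transpose P *v x"] inner_matrix_vector_transpose[of "P *v x"])
  have "x \<bullet> ((P' + P ** A + transpose A ** P + Q
        - (1/2) *\<^sub>R (P ** B ** N ** transpose B ** P)
        - (1/4) *\<^sub>R (P ** B ** N ** transpose B ** transpose P)
        - (1/4) *\<^sub>R (transpose P ** B ** N ** transpose B ** P)) *v x) = 0"
    using riccati by (simp add: N_def)
  then have riccati': "x \<bullet> (P' *v x) + x \<bullet> ((P ** A) *v x) + x \<bullet> ((transpose A ** P) *v x) + x \<bullet> (Q *v x)
      = (1/2) * (b \<bullet> (N *v a)) + (1/4) * (b \<bullet> (N *v b)) + (1/4) * (a \<bullet> (N *v a))"
    unfolding PBNBP[symmetric]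
    by (simp only: matrix_vector_mult_add_rdistrib matrix_vector_mult_diff_rdistrib
        scaleR_matrix_vector_assoc[symmetric] inner_add_right inner_diff_right inner_scaleR_right)
  have PA: "((P + transpose P) *v x) \<bullet> (A *v x) = x \<bullet> ((P ** A) *v x) + x \<bullet> ((transpose A ** P) *v x)"
    by (simp only: matrix_vector_mult_add_rdistrib inner_add_left matrix_vector_mul_assoc[symmetric]
        inner_matrix_vector_transpose[of x] transpose_transpose inner_commute[of "P *v x"] add.commute)
  have PB: "((P + transpose P) *v x) \<bullet> (B *v u) = u \<bullet> (a + b)"
    unfolding a_def b_def
    by (simp only: matrix_vector_mult_add_rdistrib matrix_vector_right_distrib inner_add_left
        inner_add_right inner_matrix_vector_transpose[of _ B] inner_commute[of u])
  have Rk: "R *v k = - (1/2) *\<^sub>R (a + b)"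
    unfolding k' by (simp only: matrix_vector_mult_scaleR cancel)
  have "(u - k) \<bullet> (R *v (u - k)) = u \<bullet> (R *v u) - 2 * (u \<bullet> (R *v k)) + k \<bullet> (R *v k)"
    by (simp add: matrix_vector_mult_diff_distrib inner_diff_left inner_diff_right sym(2)[of k u])
  also have "\<dots> = u \<bullet> (R *v u) + u \<bullet> (a + b) + (1/4) * ((a + b) \<bullet> (N *v (a + b)))"
    unfolding Rk by (simp add: k' inner_commute[of _ "a + b"])
  also have "(a + b) \<bullet> (N *v (a + b)) = 2 * (b \<bullet> (N *v a)) + b \<bullet> (N *v b) + a \<bullet> (N *v a)"
    by (simp add: matrix_vector_right_distrib inner_add_left inner_add_right sym(1)[of a b])
  finally show ?thesis
    using riccati' PA PB by (simp add: inner_add_right)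
qed

section \<open>The quadratic Krotov function of the regulator problem\<close>

locale lqr_riccati =
  fixes t0 tf :: real
    and A :: "real \<Rightarrow> real^'n^'n" and B :: "real \<Rightarrow> real^'m^'n"
    and Q :: "real \<Rightarrow> real^'n^'n" and R :: "real \<Rightarrow> real^'m^'m"
    and F :: "real^'n^'n" and P :: "real \<Rightarrow> real^'n^'n"
  assumes t0_less_tf: "t0 < tf"
    and cont_A: "continuous_on {t0..tf} A" and cont_B: "continuous_on {t0..tf} B"
    and cont_Q: "continuous_on {t0..tf} Q" and cont_R: "continuous_on {t0..tf} R"
    and pd_R: "\<And>t. t \<in> {t0..tf} \<Longrightarrow> pd_matrix (R t)"
    and P_differentiable: "\<And>t. t \<in> {t0..<tf} \<Longrightarrow> P differentiable (at t within {t0..tf})"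
    and P_equation: "\<And>t. t \<in> {t0..<tf} \<Longrightarrow>
      vector_derivative P (at t within {t0..tf})
        + P t ** A t + transpose (A t) ** P t + Q t
        - (1/2) *\<^sub>R (P t ** B t ** matrix_inv (R t) ** transpose (B t) ** P t)
        - (1/4) *\<^sub>R (P t ** B t ** matrix_inv (R t) ** transpose (B t) ** transpose (P t))
        - (1/4) *\<^sub>R (transpose (P t) ** B t ** matrix_inv (R t) ** transpose (B t) ** P t) = 0"
    and P_final: "P tf = F" and P_final_limit: "(P \<longlongrightarrow> F) (at_left tf)"
begin

definition P' :: "real \<Rightarrow> real^'n^'n" where
  "P' t = vector_derivative P (at t within {t0..tf})"

definition gain :: "real \<Rightarrow> real^'n^'m" where
  "gain t = - (1/2) *\<^sub>R (matrix_inv (R t) ** transpose (B t) ** (transpose (P t) + P t))"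

definition residual :: "(real \<Rightarrow> real^'n) \<Rightarrow> (real \<Rightarrow> real^'m) \<Rightarrow> real \<Rightarrow> real" where
  "residual x u t = (u t - gain t *v x t) \<bullet> (R t *v (u t - gain t *v x t))"

lemma gain_apply:
  "gain t *v x = - (1/2) *\<^sub>R ((matrix_inv (R t) ** transpose (B t) ** (transpose (P t) + P t)) *v x)"
  by (simp only: gain_def scaleR_matrix_vector_assoc)

lemma P_deriv: "t \<in> {t0..<tf} \<Longrightarrow> (P has_vector_derivative P' t) (at t within {t0..tf})"
  unfolding P'_def by (rule vector_derivative_works[THEN iffD1, OF P_differentiable])

lemma cont_P: "continuous_on {t0..tf} P"
proof -
  have "continuous (at t within {t0..tf}) P" if "t \<in> {t0..tf}" for t
  proof (cases "t = tf")
    case True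
    then show ?thesis
      using P_final P_final_limit t0_less_tf
      by (simp add: continuous_within at_within_Icc_at_left)
  next
    case False
    then show ?thesis
      using that has_vector_derivative_continuous[OF P_deriv] by force
  qed
  then show ?thesis
    by (simp add: continuous_on_eq_continuous_within)
qed

lemma cont_matrix_inv_R: "continuous_on {t0..tf} (\<lambda>t. matrix_inv (R t))"
  by (rule continuous_on_matrix_inv[OF cont_R invertible_pd_matrix[OF pd_R]])

lemma cont_gain: "continuous_on {t0..tf} gain"
  unfolding gain_def
  by (intro continuous_intros continuous_on_matrix_intros cont_matrix_inv_R cont_B cont_P)

text \<open>Differentiability of \<open>P\<close> alone would not make \<open>q\<close> continuously differentiable; the matrix
  equation expresses the derivative through continuous functions.\<close>

lemma cont_P': "continuous_on {t0..<tf} P'"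
proof (rule continuous_on_eq)
  show "continuous_on {t0..<tf} (\<lambda>t. (1/2) *\<^sub>R (P t ** B t ** matrix_inv (R t) ** transpose (B t) ** P t)
        + (1/4) *\<^sub>R (P t ** B t ** matrix_inv (R t) ** transpose (B t) ** transpose (P t))
        + (1/4) *\<^sub>R (transpose (P t) ** B t ** matrix_inv (R t) ** transpose (B t) ** P t)
        - P t ** A t - transpose (A t) ** P t - Q t)"
    by (rule continuous_on_subset[of "{t0..tf}"])
      (auto intro!: continuous_intros continuous_on_matrix_intros
        cont_matrix_inv_R cont_A cont_B cont_Q cont_P)
qed (use P_equation in \<open>simp add: P'_def algebra_simps\<close>)

lemma complete_square:
  assumes "t \<in> {t0..<tf}"
  shows "x \<bullet> (P' t *v x) + ((P t + transpose (P t)) *v x) \<bullet> (A t *v x + B t *v u)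
      + x \<bullet> (Q t *v x) + u \<bullet> (R t *v u)
    = (u - gain t *v x) \<bullet> (R t *v (u - gain t *v x))"
  by (rule riccati_complete_square[OF pd_R P_equation[folded P'_def] gain_apply])
    (use assms in auto)

text \<open>The residual is \<open>s\<close> along a process (\<open>krotov_s_eq_square\<close>). Its sign is what makes both \<open>s\<close> minimal at
  the feedback control and the feedback control optimal.\<close>

lemma residual_nonneg: "t \<in> {t0..tf} \<Longrightarrow> 0 \<le> residual x u t"
  using pd_R[of t] unfolding pd_matrix_def residual_def
  by (cases "u t - gain t *v x t = 0") (auto intro: less_imp_le)

lemma krotov_function_quadratic: "krotov_function t0 tf (\<lambda>x t. x \<bullet> (P t *v x))"
proof -
  have P_snd: "continuous_on (UNIV \<times> {t0..tf}) (\<lambda>z :: (real^'n) \<times> real. P (snd z))"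
    by (rule continuous_on_compose2[OF cont_P]) (auto intro: continuous_intros)
  have P'_snd: "continuous_on (UNIV \<times> {t0..<tf}) (\<lambda>z :: (real^'n) \<times> real. P' (snd z))"
    by (rule continuous_on_compose2[OF cont_P']) (auto intro: continuous_intros)
  define gx where "gx z = (P (snd z) + transpose (P (snd z))) *v fst z" for z
  define gt where "gt z = fst z \<bullet> (P' (snd z) *v fst z)" for z
  have "continuous_on (UNIV \<times> {t0..tf}) (\<lambda>(x, t). x \<bullet> (P t *v x))"
    unfolding case_prod_unfold
    by (intro continuous_intros continuous_on_matrix_intros P_snd)
  moreover have "continuous_on (UNIV \<times> {t0..<tf}) gx"
    unfolding gx_def
    by (intro continuous_intros continuous_on_matrix_intros continuous_on_subset[OF P_snd]) auto
  moreover have "continuous_on (UNIV \<times> {t0..<tf}) gt"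
    unfolding gt_def by (intro continuous_intros continuous_on_matrix_intros P'_snd)
  moreover have "((\<lambda>(y, r). y \<bullet> (P r *v y)) has_derivative (\<lambda>(h, k). gx (x, t) \<bullet> h + gt (x, t) * k))
      (at (x, t) within UNIV \<times> {t0..tf})" if t: "t \<in> {t0..<tf}" for x t
  proof -
    have "((\<lambda>z. P (snd z)) has_derivative (\<lambda>h. snd h *\<^sub>R P' t)) (at (x, t) within UNIV \<times> {t0..tf})"
    proof (rule has_derivative_in_compose[where f = snd and g = P])
      show "(P has_derivative (\<lambda>h. h *\<^sub>R P' t)) (at (snd (x, t)) within snd ` (UNIV \<times> {t0..tf}))"
        using P_deriv[OF t] by (simp add: has_vector_derivative_def)
    qed (auto intro!: derivative_intros)
    from has_derivative_quadratic_form[OF has_derivative_fst[OF has_derivative_ident] this]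
    show ?thesis
      by (simp add: case_prod_unfold gx_def gt_def scaleR_matrix_vector_assoc[symmetric] mult.commute)
  qed
  ultimately show ?thesis
    unfolding krotov_function_def by blast
qed

lemma krotov_s_eq_square:
  assumes t: "t \<in> {t0..<tf}"
  shows "krotov_s t0 tf A B Q R (\<lambda>x t. x \<bullet> (P t *v x)) x u t
    = (u - gain t *v x) \<bullet> (R t *v (u - gain t *v x))"
proof -
  have "((\<lambda>r. x \<bullet> (P r *v x)) has_vector_derivative x \<bullet> (P' t *v x)) (at t within {t0..tf})"
    using has_vector_derivative_quadratic_form[OF has_vector_derivative_const P_deriv[OF t]] by simp
  then have "vector_derivative (\<lambda>r. x \<bullet> (P r *v x)) (at t within {t0..tf}) = x \<bullet> (P' t *v x)"
    using t by (intro vector_derivative_within_closed_interval) auto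
  moreover have "((\<lambda>y. y \<bullet> (P t *v y)) has_derivative (\<lambda>h. ((P t + transpose (P t)) *v x) \<bullet> h)) (at x)"
    using has_derivative_quadratic_form[OF has_derivative_ident has_derivative_const] by simp
  then have "frechet_derivative (\<lambda>y. y \<bullet> (P t *v y)) (at x) = (\<lambda>h. ((P t + transpose (P t)) *v x) \<bullet> h)"
    by (rule frechet_derivative_at[symmetric])
  ultimately show ?thesis
    using complete_square[OF t] by (simp add: krotov_s_def)
qed

lemma closed_loop_exists:
  obtains x where "admissible t0 tf A B x0 x (\<lambda>t. gain t *v x t)"
proof -
  have "continuous_on {t0..tf} (\<lambda>t. A t + B t ** gain t)"
    by (intro continuous_intros continuous_on_matrix_intros cont_A cont_B cont_gain)
  from linear_ode_solution_exists[OF less_imp_le[OF t0_less_tf] this, of x0]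
  obtain x where "x t0 = x0" and x: "\<And>t. t \<in> {t0..tf} \<Longrightarrow>
      (x has_vector_derivative (A t + B t ** gain t) *v x t) (at t within {t0..tf})"
    by metis
  moreover have "continuous_on {t0..tf} x"
    using x by (intro continuous_on_vector_derivative)
  ultimately have "admissible t0 tf A B x0 x (\<lambda>t. gain t *v x t)"
    unfolding admissible_def
    by (auto simp: matrix_vector_mult_add_rdistrib matrix_vector_mul_assoc intro!: exI[of _ "{}"])
  then show thesis
    by (rule that)
qed

lemma quadratic_solving_function: "solving_function t0 tf A B Q R F x0 (\<lambda>x t. x \<bullet> (P t *v x))"
proof -
  obtain x where "admissible t0 tf A B x0 x (\<lambda>t. gain t *v x t)"
    by (rule closed_loop_exists)
  moreover have "is_arg_min (\<lambda>(y, v). krotov_s t0 tf A B Q R (\<lambda>x t. x \<bullet> (P t *v x)) y v t)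
      (\<lambda>_. True) (x t, gain t *v x t)" if "t \<in> {t0..<tf}" for t
    using residual_nonneg[of t "\<lambda>_. y" "\<lambda>_. v" for y v] that
    by (auto simp: is_arg_min_def krotov_s_eq_square residual_def not_less)
  moreover have "is_arg_min (krotov_sf tf F (\<lambda>x t. x \<bullet> (P t *v x))) (\<lambda>_. True) (x tf)"
    by (simp add: is_arg_min_def krotov_sf_def P_final)
  ultimately show ?thesis
    unfolding solving_function_def using krotov_function_quadratic by blast
qed

text \<open>The derivative of \<open>x \<bullet> (P *v x)\<close> along an admissible process is \<open>s\<close> minus the running cost, so
  integrating it exhibits twice the cost as \<open>x0 \<bullet> (P t0 *v x0)\<close>, which does not depend on the process,
  plus the integral of the non-negative residual. The fundamental theorem of calculus tolerates the
  finitely many jumps of the control, and also the end point \<open>tf\<close>, where \<open>P\<close> is merely continuous.\<close>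

lemma residual_has_integral:
  assumes adm: "admissible t0 tf A B x0 x u"
    and int: "running_cost Q R x u integrable_on {t0..tf}"
  shows "(residual x u has_integral 2 * lqr_cost t0 tf Q R F x u - x0 \<bullet> (P t0 *v x0)) {t0..tf}"
proof -
  from adm obtain S where "x t0 = x0" and cont_x: "continuous_on {t0..tf} x" and "finite S"
    and x: "\<And>t. t \<in> {t0..tf} - S \<Longrightarrow>
      (x has_vector_derivative (A t *v x t + B t *v u t)) (at t within {t0..tf})"
    unfolding admissible_def by blast
  have "((\<lambda>t. residual x u t - running_cost Q R x u t) has_integral
      x tf \<bullet> (P tf *v x tf) - x t0 \<bullet> (P t0 *v x t0)) {t0..tf}"
  proof (rule fundamental_theorem_of_calculus_interior_strong[OF \<open>finite S\<close>])
    show "((\<lambda>r. x r \<bullet> (P r *v x r)) has_vector_derivative residual x u t - running_cost Q R x u t) (at t)"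
      if t: "t \<in> {t0<..<tf} - S" for t
    proof -
      have "((\<lambda>r. x r \<bullet> (P r *v x r)) has_vector_derivative
          ((P t + transpose (P t)) *v x t) \<bullet> (A t *v x t + B t *v u t) + x t \<bullet> (P' t *v x t))
          (at t within {t0..tf})"
        using t by (intro has_vector_derivative_quadratic_form x P_deriv) auto
      moreover have "((P t + transpose (P t)) *v x t) \<bullet> (A t *v x t + B t *v u t) + x t \<bullet> (P' t *v x t)
          = residual x u t - running_cost Q R x u t"
        using complete_square[of t "x t" "u t"] t by (simp add: residual_def running_cost_def)
      ultimately show ?thesis
        using t by (simp add: at_within_Icc_at)
    qed
    show "continuous_on {t0..tf} (\<lambda>r. x r \<bullet> (P r *v x r))"
      by (intro continuous_intros continuous_on_matrix_intros cont_x cont_P)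
  qed (use t0_less_tf in auto)
  from has_integral_add[OF this integrable_integral[OF int]] show ?thesis
    by (simp add: lqr_cost_def \<open>x t0 = x0\<close> P_final algebra_simps)
qed

text \<open>Along the closed loop the residual vanishes, so its cost equals the common lower bound.\<close>

lemma closed_loop_globally_optimal:
  assumes adm: "admissible t0 tf A B x0 x u"
    and u: "\<And>t. t \<in> {t0..tf} \<Longrightarrow> u t = gain t *v x t"
  shows "globally_optimal t0 tf A B Q R F x0 x u"
proof -
  have "continuous_on {t0..tf} x"
    using adm by (simp add: admissible_def)
  then have "continuous_on {t0..tf}
      (\<lambda>t. x t \<bullet> (Q t *v x t) + (gain t *v x t) \<bullet> (R t *v (gain t *v x t)))"
    by (intro continuous_intros continuous_on_matrix_intros cont_Q cont_R cont_gain)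
  then have "continuous_on {t0..tf} (running_cost Q R x u)"
    by (rule continuous_on_eq) (simp add: running_cost_def u)
  then have int: "running_cost Q R x u integrable_on {t0..tf}"
    by (rule integrable_continuous_real)
  have "(residual x u has_integral 0) {t0..tf}"
    by (rule has_integral_is_0) (simp add: residual_def u)
  then have "2 * lqr_cost t0 tf Q R F x u = x0 \<bullet> (P t0 *v x0)"
    using has_integral_unique[OF residual_has_integral[OF adm int]] by fastforce
  then have "lqr_cost t0 tf Q R F x u \<le> lqr_cost t0 tf Q R F y v"
    if "admissible t0 tf A B x0 y v" "running_cost Q R y v integrable_on {t0..tf}" for y v
    using has_integral_nonneg[OF residual_has_integral[OF that] residual_nonneg] by simp
  then show ?thesis
    unfolding globally_optimal_def using adm int by blast
qed

lemma gain_optimal_control_law: "optimal_control_law t0 tf A B Q R F x0 (\<lambda>x t. gain t *v x)"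
  unfolding optimal_control_law_def
proof (intro conjI allI impI)
  show "\<exists>x. admissible t0 tf A B x0 x (\<lambda>t. gain t *v x t)"
    by (rule closed_loop_exists) blast
qed (blast intro: closed_loop_globally_optimal)

end

section \<open>Optimality of the quadratic feedback\<close>

theorem corollary1:
  fixes t0 tf :: real
    and A :: "real \<Rightarrow> real^'n^'n" and B :: "real \<Rightarrow> real^'m^'n"
    and Q :: "real \<Rightarrow> real^'n^'n" and R :: "real \<Rightarrow> real^'m^'m"
    and F :: "real^'n^'n" and P :: "real \<Rightarrow> real^'n^'n" and x0 :: "real^'n"
  assumes "t0 < tf"
    and "continuous_on {t0..tf} A" and "continuous_on {t0..tf} B"
    and "continuous_on {t0..tf} Q" and "continuous_on {t0..tf} R"
    and "\<forall>t\<in>{t0..tf}. psd_matrix (Q t)" and "\<forall>t\<in>{t0..tf}. pd_matrix (R t)"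
    and P_differentiable:
      "\<forall>i j. \<forall>t\<in>{t0..<tf}. (\<lambda>r. P r $ i $ j) differentiable (at t within {t0..tf})"
    and P_equation: "\<forall>t\<in>{t0..<tf}.
      vector_derivative P (at t within {t0..tf})
        + P t ** A t + transpose (A t) ** P t + Q t
        - (1/2) *\<^sub>R (P t ** B t ** matrix_inv (R t) ** transpose (B t) ** P t)
        - (1/4) *\<^sub>R (P t ** B t ** matrix_inv (R t) ** transpose (B t) ** transpose (P t))
        - (1/4) *\<^sub>R (transpose (P t) ** B t ** matrix_inv (R t) ** transpose (B t) ** P t) = 0"
    and P_final: "P tf = F" and P_final_limit: "(P \<longlongrightarrow> F) (at_left tf)"
  shows "solving_function t0 tf A B Q R F x0 (\<lambda>x t. x \<bullet> (P t *v x)) \<and>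
    optimal_control_law t0 tf A B Q R F x0
      (\<lambda>x t. - (1/2) *\<^sub>R ((matrix_inv (R t) ** transpose (B t) ** (transpose (P t) + P t)) *v x))"
proof -
  have "P differentiable (at t within {t0..tf})" if "t \<in> {t0..<tf}" for t
    using P_differentiable that by (intro matrix_differentiable_componentwise) blast
  then interpret lqr_riccati t0 tf A B Q R F P
    using assms unfolding lqr_riccati_def by blast
  show ?thesis
    using quadratic_solving_function gain_optimal_control_law by (simp only: gain_apply)
qed

end
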